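(* Let $M=(M,d)$ be a global NPC space and let $x_1,\dots,x_n,y_1,\dots,y_n\in M$ be such that $$\frac1n\sum_{i=1}^{n}\delta_{x_{i}}\prec\frac1n\sum_{i=1}^{n}\delta_{y_{i}}$$ in $M$. Let $f:M^n\to\mathbb{R}$ be a continuous convex function that is invariant under permutations of the coordinates. Then $$f(x_1,\dots,x_n)\le f(y_1,\dots,y_n).$$
   Context: A global NPC space is a complete metric space $M=(M,d)$ such that for each pair $x_0,x_1\in M$ there is $y\in M$ with $d^2(z,y)\le \frac12 d^2(z,x_0)+\frac12 d^2(z,x_1)-\frac14 d^2(x_0,x_1)$ for all $z\in M$. In such a space any two points $x_0,x_1$ are joined by a unique geodesic $\gamma:[0,1]\to M$ (parametrized proportionally to arc length, so $d(\gamma(s),\gamma(t))=|s-t|\,d(x_0,x_1)$). The power $M^n$ carries the product metric $d_{M^n}(u,v)=\left(\sum_{i=1}^n d(u_i,v_i)^2\right)^{1/2}$, for which it is again a global NPC space. A function $f:M^n\to\mathbb{R}$ is convex if $f(\gamma(t))\le(1-t)f(\gamma(0))+tf(\gamma(1))$ for every geodesic $\gamma:[0,1]\to M^n$ and $t\in[0,1]$. Majorization: $\frac1n\sum_{i=1}^{n}\delta_{x_{i}}\prec\frac1n\sum_{i=1}^{n}\delta_{y_{i}}$ means that there exists a doubly stochastic $n\times n$ matrix $A=(a_{ij})$ (nonnegative entries, each row and each column summing to $1$) such that, for each $i=1,\dots,n$, $$x_i=\arg\min_{z\in M}\frac12\sum_{j=1}^n a_{ij}d^2(z,y_j)$$ (in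 a global NPC space this minimizer exists and is unique). *)

theory Defs
  imports "HOL-Analysis.Analysis"
begin

class global_npc_space = complete_space +
  assumes npc_midpoint:
    "\<exists>y. \<forall>z. (dist z y)\<^sup>2 \<le> 1/2 * (dist z x0)\<^sup>2 + 1/2 * (dist z x1)\<^sup>2 - 1/4 * (dist x0 x1)\<^sup>2"

text \<open>Only the restriction of \<^term>\<open>\<gamma>\<close> to the unit interval is relevant.\<close>

definition geodesic :: "(real \<Rightarrow> 'a::metric_space) \<Rightarrow> bool" where
  "geodesic \<gamma> \<longleftrightarrow>
     (\<forall>s\<in>{0..1}. \<forall>t\<in>{0..1}. dist (\<gamma> s) (\<gamma> t) = \<bar>s - t\<bar> * dist (\<gamma> 0) (\<gamma> 1))"

definition geodesically_convex :: "('a::metric_space \<Rightarrow> real) \<Rightarrow> bool" where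
  "geodesically_convex f \<longleftrightarrow>
     (\<forall>\<gamma>. geodesic \<gamma> \<longrightarrow> (\<forall>t\<in>{0..1}. f (\<gamma> t) \<le> (1 - t) * f (\<gamma> 0) + t * f (\<gamma> 1)))"

definition doubly_stochastic :: "real ^ 'n ^ 'n \<Rightarrow> bool" where
  "doubly_stochastic A \<longleftrightarrow>
     (\<forall>i j. 0 \<le> A $ i $ j) \<and>
     (\<forall>i. (\<Sum>j\<in>UNIV. A $ i $ j) = 1) \<and>
     (\<forall>j. (\<Sum>i\<in>UNIV. A $ i $ j) = 1)"

text \<open>
  The power \<open>M\<^sup>n\<close> is the type \<open>'a ^ 'n\<close>, whose library metric is the l2 product metric
  (\<open>dist_vec_def\<close>). The relation below is majorization of the uniform measures on the
  families \<open>x\<close> and \<open>y\<close>, repetitions counted. It does not depend on the enumeration of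
  either family, since permuting the rows or the columns of a doubly stochastic matrix
  gives a doubly stochastic matrix.
\<close>

definition majorized_by :: "'a::metric_space ^ 'n \<Rightarrow> 'a ^ 'n \<Rightarrow> bool" where
  "majorized_by x y \<longleftrightarrow>
     (\<exists>A :: real ^ 'n ^ 'n. doubly_stochastic A \<and>
        (\<forall>i. is_arg_min (\<lambda>z. 1/2 * (\<Sum>j\<in>UNIV. A $ i $ j * (dist z (y $ j))\<^sup>2)) (\<lambda>z. True) (x $ i)))"

definition permutation_invariant :: "('a ^ 'n \<Rightarrow> 'b) \<Rightarrow> bool" where
  "permutation_invariant f \<longleftrightarrow>
     (\<forall>p :: 'n \<Rightarrow> 'n. bij p \<longrightarrow> (\<forall>u. f (\<chi> i. u $ p i) = f u))"

end

theory Submission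
  imports Defs
begin

text \<open>
  The sublevel set \<open>C = {u. f u \<le> f y}\<close> is closed, convex and contains every rearrangement of
  \<open>y\<close>. If \<open>p\<close> is the nearest point of \<open>C\<close> to \<open>x\<close>, then
  \<open>d(p,q)\<^sup>2 + d(x,p)\<^sup>2 \<le> d(x,q)\<^sup>2\<close> for every \<open>q \<in> C\<close>. Averaging this over the
  rearrangements \<open>q\<close> of \<open>y\<close>, with the weights that Birkhoff's theorem attaches to the doubly
  stochastic matrix, and using that each \<open>x\<^sub>i\<close> minimizes its weighted sum of squared distances,
  gives \<open>d(x,p) = 0\<close>; hence \<open>x \<in> C\<close>.
\<close>

section \<open>Weighted sums against doubly stochastic matrices\<close>

text \<open>Induction on the size of \<open>I\<close>, as in Halmos and Vaughan. If a proper
  nonempty \<open>J\<close> has exactly \<open>card J\<close> neighbours, match \<open>J\<close>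
  into these and the rest of \<open>I\<close> outside them. Otherwise every proper nonempty subset
  has a spare neighbour, so one index can be matched arbitrarily.\<close>

lemma hall_marriage:
  fixes N :: "'a \<Rightarrow> 'b set"
  assumes "finite I" and "\<And>i. i \<in> I \<Longrightarrow> finite (N i)"
    and "\<And>J. J \<subseteq> I \<Longrightarrow> card J \<le> card (\<Union>(N ` J))"
  shows "\<exists>\<phi>. inj_on \<phi> I \<and> (\<forall>i\<in>I. \<phi> i \<in> N i)"
  using assms
proof (induction "card I" arbitrary: I N rule: less_induct)
  case less
  note fin = less.prems(1) and finN = less.prems(2) and hall = less.prems(3)
  have finU: "finite (\<Union>(N ` J))" if "J \<subseteq> I" for J
    using that fin finN by (meson finite_UN finite_subset subsetD)
  consider (empty) "I = {}"
    | (tight) J where "J \<subset> I" "J \<noteq> {}" "card (\<Union>(N ` J)) = card J"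
    | (loose) "I \<noteq> {}" "\<And>J. J \<subset> I \<Longrightarrow> J \<noteq> {} \<Longrightarrow> card J < card (\<Union>(N ` J))"
    using hall by (metis le_neq_implies_less psubset_imp_subset)
  then show ?case
  proof cases
    case empty
    then show ?thesis by simp
  next
    case tight
    have finJ: "finite J" and JI: "J \<subseteq> I" using tight fin finite_subset by auto
    obtain \<phi> where \<phi>: "inj_on \<phi> J" "\<forall>i\<in>J. \<phi> i \<in> N i"
      using less.hyps[of J N] tight fin finN hall by (meson JI finJ order_trans psubset_card_mono subsetD)
    let ?N = "\<lambda>i. N i - \<Union>(N ` J)"
    \<comment> \<open>\<open>J \<union> K\<close> has at least \<open>card J + card K\<close>
      neighbours, and by tightness only \<open>card J\<close> of them belong to
      \<open>J\<close>.\<close>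
    have "card K \<le> card (\<Union>(?N ` K))" if K: "K \<subseteq> I - J" for K
    proof -
      have finK: "finite K" using K fin finite_subset by auto
      have "card J + card K = card (J \<union> K)"
        using K finJ finK by (subst card_Un_disjoint) auto
      also have "\<dots> \<le> card (\<Union>(N ` (J \<union> K)))" using hall[of "J \<union> K"] K JI by blast
      also have "\<Union>(N ` (J \<union> K)) = \<Union>(N ` J) \<union> \<Union>(?N ` K)" by auto
      also have "card \<dots> \<le> card (\<Union>(N ` J)) + card (\<Union>(?N ` K))" by (rule card_Un_le)
      finally show ?thesis using tight by simp
    qed
    moreover have "card (I - J) < card I"
      using tight fin by (metis card_Diff_subset card_gt_0_iff diff_less finJ JI order_le_less_trans psubset_card_mono zero_le)
    ultimately obtain \<psi> where \<psi>: "inj_on \<psi> (I - J)" "\<forall>i\<in>I - J. \<psi> i \<in> ?N i"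
      using less.hyps[of "I - J" ?N] fin finN by auto
    have cross: "\<phi> j \<noteq> \<psi> i" if "j \<in> J" "i \<in> I - J" for i j
      using \<phi>(2) \<psi>(2) that by (metis DiffD2 UN_I)
    let ?\<chi> = "\<lambda>i. if i \<in> J then \<phi> i else \<psi> i"
    have "inj_on ?\<chi> I"
    proof (rule inj_onI)
      fix i j assume "i \<in> I" "j \<in> I" "?\<chi> i = ?\<chi> j"
      then show "i = j" using \<phi>(1) \<psi>(1) cross[of i j] cross[of j i]
        by (cases "i \<in> J"; cases "j \<in> J") (auto dest: inj_onD)
    qed
    moreover have "\<forall>i\<in>I. ?\<chi> i \<in> N i" using \<phi> \<psi> by auto
    ultimately show ?thesis by blast
  next
    case loose
    obtain i0 where i0: "i0 \<in> I" using loose by auto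
    have "card {i0} \<le> card (N i0)" using hall[of "{i0}"] i0 by simp
    then obtain y where y: "y \<in> N i0" by fastforce
    let ?N = "\<lambda>i. N i - {y}"
    \<comment> \<open>Deleting \<open>y\<close> costs at most one neighbour, which the strict
      inequality absorbs.\<close>
    have "card K \<le> card (\<Union>(?N ` K))" if K: "K \<subseteq> I - {i0}" for K
    proof (cases "K = {}")
      case False
      then have "card K < card (\<Union>(N ` K))" using K i0 by (intro loose(2)) auto
      moreover have "\<Union>(?N ` K) = \<Union>(N ` K) - {y}" by auto
      moreover have "finite (\<Union>(N ` K))" using K by (intro finU) auto
      ultimately show ?thesis by (auto simp: card_Diff_singleton_if)
    qed simp
    moreover have "card (I - {i0}) < card I" using fin i0 by (meson card_Diff1_less)
    ultimately obtain \<psi> where \<psi>: "inj_on \<psi> (I - {i0})" "\<forall>i\<in>I - {i0}. \<psi> i \<in> ?N i"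
      using less.hyps[of "I - {i0}" ?N] fin finN by auto
    let ?\<chi> = "\<psi>(i0 := y)"
    have "inj_on ?\<chi> I"
    proof (rule inj_onI)
      fix i j assume "i \<in> I" "j \<in> I" "?\<chi> i = ?\<chi> j"
      then show "i = j" using \<psi> by (cases "i = i0"; cases "j = i0") (auto dest: inj_onD)
    qed
    moreover have "\<forall>i\<in>I. ?\<chi> i \<in> N i" using \<psi> y by auto
    ultimately show ?thesis by blast
  qed
qed

text \<open>Hall's condition for the positive entries follows by counting mass: the rows in
  \<open>J\<close> carry \<open>s * card J\<close>, and all of it lies in the columns that they
  meet, each of which holds only \<open>s\<close>.\<close>

lemma positive_permutation:
  fixes a :: "'n::finite \<Rightarrow> 'n \<Rightarrow> real"
  assumes nonneg: "\<And>i j. 0 \<le> a i j" and "0 < s"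
    and row: "\<And>i. (\<Sum>j\<in>UNIV. a i j) = s" and col: "\<And>j. (\<Sum>i\<in>UNIV. a i j) = s"
  obtains \<sigma> where "bij \<sigma>" "\<And>i. 0 < a i (\<sigma> i)"
proof -
  let ?N = "\<lambda>i. {j. 0 < a i j}"
  have "card J \<le> card (\<Union>(?N ` J))" for J
  proof -
    let ?U = "\<Union>(?N ` J)"
    have "s * card J = (\<Sum>i\<in>J. \<Sum>j\<in>UNIV. a i j)" by (simp add: row)
    also have "\<dots> = (\<Sum>i\<in>J. \<Sum>j\<in>?U. a i j)"
    proof (rule sum.cong[OF refl])
      fix i assume "i \<in> J"
      then have "a i j = 0" if "j \<notin> ?U" for j using that nonneg[of i j] by (auto simp: not_less)
      then show "(\<Sum>j\<in>UNIV. a i j) = (\<Sum>j\<in>?U. a i j)"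
        by (intro sum.mono_neutral_right) auto
    qed
    also have "\<dots> = (\<Sum>j\<in>?U. \<Sum>i\<in>J. a i j)" by (rule sum.swap)
    also have "\<dots> \<le> (\<Sum>j\<in>?U. \<Sum>i\<in>UNIV. a i j)"
      by (intro sum_mono sum_mono2) (auto simp: nonneg)
    also have "\<dots> = s * card ?U" by (simp add: col)
    finally show ?thesis using \<open>0 < s\<close> by simp
  qed
  then obtain \<sigma> where "inj_on \<sigma> UNIV" "\<forall>i\<in>UNIV. \<sigma> i \<in> ?N i"
    using hall_marriage[of UNIV ?N] by auto
  then show ?thesis using that[of \<sigma>] finite_UNIV_inj_surj[OF finite] by (auto simp: bij_def)
qed

text \<open>Birkhoff's theorem in dual form, with common line sum \<open>s\<close> so that the induction can
  peel off multiples of permutation matrices.\<close>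

lemma birkhoff_dual:
  fixes a b :: "'n::finite \<Rightarrow> 'n \<Rightarrow> real"
  assumes "\<And>i j. 0 \<le> a i j"
    and "\<And>i. (\<Sum>j\<in>UNIV. a i j) = s" and "\<And>j. (\<Sum>i\<in>UNIV. a i j) = s"
    and b: "\<And>\<sigma>. bij \<sigma> \<Longrightarrow> 0 \<le> (\<Sum>i\<in>UNIV. b i (\<sigma> i))"
  shows "0 \<le> (\<Sum>i\<in>UNIV. \<Sum>j\<in>UNIV. a i j * b i j)"
  using assms(1-3)
proof (induction "card {(i, j). a i j \<noteq> 0}" arbitrary: a s rule: less_induct)
  case less
  note nonneg = less.prems(1) and row = less.prems(2) and col = less.prems(3)
  have "0 \<le> s" using row nonneg by (metis sum_nonneg)
  show ?case
  proof (cases "s = 0")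
    case True
    then have "a i j = 0" for i j
      using row[of i] nonneg by (simp add: sum_nonneg_eq_0_iff)
    then show ?thesis by simp
  next
    case False
    with \<open>0 \<le> s\<close> have "0 < s" by simp
    then obtain \<sigma> where \<sigma>: "bij \<sigma>" "\<And>i. 0 < a i (\<sigma> i)"
      using positive_permutation[OF nonneg _ row col] by blast
    \<comment> \<open>With the smallest entry along \<open>\<sigma>\<close>, subtracting
      \<open>l\<close> times the permutation matrix keeps all entries nonnegative, lowers each line
      sum by \<open>l\<close> and annihilates the entry at \<open>(k, \<sigma> k)\<close>.\<close>
    define l where "l = Min (range (\<lambda>i. a i (\<sigma> i)))"
    have "l \<in> range (\<lambda>i. a i (\<sigma> i))" unfolding l_def by (intro Min_in) auto
    then obtain k where k: "l = a k (\<sigma> k)" by blast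
    have lle: "l \<le> a i (\<sigma> i)" for i unfolding l_def by (intro Min_le) auto
    have "0 < l" using k \<sigma> by simp
    define a' where "a' = (\<lambda>i j. a i j - (if j = \<sigma> i then l else 0))"
    have nonneg': "0 \<le> a' i j" for i j using lle nonneg by (simp add: a'_def)
    have row': "(\<Sum>j\<in>UNIV. a' i j) = s - l" for i
      by (simp add: a'_def sum_subtractf row)
    have col': "(\<Sum>i\<in>UNIV. a' i j) = s - l" for j
    proof -
      have "(j = \<sigma> i) = (i = inv \<sigma> j)" for i
        using \<sigma>(1) by (metis bij_inv_eq_iff)
      then show ?thesis by (simp add: a'_def sum_subtractf col)
    qed
    \<comment> \<open>The support strictly shrinks, so the induction hypothesis applies to
      \<open>a'\<close> with line sum \<open>s - l\<close>.\<close>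
    have "{(i, j). a' i j \<noteq> 0} \<subseteq> {(i, j). a i j \<noteq> 0} - {(k, \<sigma> k)}"
      using k \<sigma>(2) by (auto simp: a'_def split: if_splits) (metis less_irrefl)+
    moreover have "(k, \<sigma> k) \<in> {(i, j). a i j \<noteq> 0}"
      using \<sigma>(2)[of k] by simp
    ultimately have "{(i, j). a' i j \<noteq> 0} \<subset> {(i, j). a i j \<noteq> 0}" by blast
    then have "card {(i, j). a' i j \<noteq> 0} < card {(i, j). a i j \<noteq> 0}"
      by (intro psubset_card_mono) auto
    then have "0 \<le> (\<Sum>i\<in>UNIV. \<Sum>j\<in>UNIV. a' i j * b i j)"
      using less.hyps nonneg' row' col' by blast
    moreover have "(\<Sum>j\<in>UNIV. a i j * b i j) = (\<Sum>j\<in>UNIV. a' i j * b i j) + l * b i (\<sigma> i)" for i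
      by (simp add: a'_def left_diff_distrib sum_subtractf if_distrib[of "\<lambda>c. c * _"] cong: if_cong)
    moreover have "0 \<le> l * (\<Sum>i\<in>UNIV. b i (\<sigma> i))" using \<open>0 < l\<close> b[OF \<sigma>(1)] by simp
    ultimately show ?thesis by (simp add: sum.distrib sum_distrib_left)
  qed
qed

section \<open>Geodesics in global NPC spaces\<close>

text \<open>The choice is harmless: the inequality determines the point, namely the unique metric
  midpoint of \<open>a\<close> and \<open>b\<close>.\<close>

definition npc_mid :: "'a::global_npc_space \<Rightarrow> 'a \<Rightarrow> 'a" where
  "npc_mid a b = (SOME y. \<forall>z. (dist z y)\<^sup>2 \<le> 1/2 * (dist z a)\<^sup>2 + 1/2 * (dist z b)\<^sup>2 - 1/4 * (dist a b)\<^sup>2)"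

lemma npc_mid:
  "(dist z (npc_mid a b))\<^sup>2 \<le> 1/2 * (dist z a)\<^sup>2 + 1/2 * (dist z b)\<^sup>2 - 1/4 * (dist a b)\<^sup>2"
  unfolding npc_mid_def using someI_ex[OF npc_midpoint[of a b]] by blast

text \<open>For \<open>z = m\<close> the right-hand side of the NPC inequality vanishes.\<close>

lemma npc_mid_unique:
  fixes a b m :: "'a::global_npc_space"
  assumes "dist m a = dist a b / 2" "dist m b = dist a b / 2"
  shows "npc_mid a b = m"
proof -
  have "(dist m (npc_mid a b))\<^sup>2 \<le> 0"
    using npc_mid[of m a b] assms by (simp add: power2_eq_square)
  then show ?thesis by simp
qed

text \<open>Putting \<open>z\<close> at either endpoint bounds both distances by half; the triangle
  inequality forces equality.\<close>

lemma dist_npc_mid: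
  fixes a b :: "'a::global_npc_space"
  shows "dist a (npc_mid a b) = dist a b / 2" "dist (npc_mid a b) b = dist a b / 2"
proof -
  have "(dist a (npc_mid a b))\<^sup>2 \<le> (dist a b / 2)\<^sup>2"
    using npc_mid[of a a b] by (simp add: power2_eq_square)
  then have 1: "dist a (npc_mid a b) \<le> dist a b / 2" by (rule power2_le_imp_le) simp
  have "(dist b (npc_mid a b))\<^sup>2 \<le> (dist a b / 2)\<^sup>2"
    using npc_mid[of b a b] by (simp add: power2_eq_square dist_commute)
  then have 2: "dist (npc_mid a b) b \<le> dist a b / 2"
    by (subst dist_commute) (rule power2_le_imp_le, simp_all)
  have "dist a b \<le> dist a (npc_mid a b) + dist (npc_mid a b) b" by (rule dist_triangle)
  with 1 2 show "dist a (npc_mid a b) = dist a b / 2" "dist (npc_mid a b) b = dist a b / 2"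
    by auto
qed

text \<open>Approximates the point at parameter \<open>t\<close> of the geodesic from
  \<open>a\<close> to \<open>b\<close>: halve \<open>k\<close> times, keep the half containing
  \<open>t\<close>, and return the left end of the last piece.\<close>

primrec bisect :: "nat \<Rightarrow> 'a::global_npc_space \<Rightarrow> 'a \<Rightarrow> real \<Rightarrow> 'a" where
  "bisect 0 a b t = a"
| "bisect (Suc k) a b t =
     (if t \<le> 1/2 then bisect k a (npc_mid a b) (2 * t) else bisect k (npc_mid a b) b (2 * t - 1))"

text \<open>Rounding is towards \<open>a\<close>, so no error term appears.\<close>

lemma dist_bisect_left:
  "t \<in> {0..1} \<Longrightarrow> dist a (bisect k a b t) \<le> t * dist a b"
proof (induction k arbitrary: a b t)
  case (Suc k)
  let ?m = "npc_mid a b"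
  show ?case
  proof (cases "t \<le> 1/2")
    case True
    then show ?thesis using Suc.IH[of "2 * t" a ?m] Suc.prems by (simp add: dist_npc_mid)
  next
    case False
    then have "dist ?m (bisect k ?m b (2 * t - 1)) \<le> (2 * t - 1) * (dist a b / 2)"
      using Suc.IH[of "2 * t - 1" ?m b] Suc.prems by (simp add: dist_npc_mid)
    then have "dist a (bisect k ?m b (2 * t - 1)) \<le> dist a b / 2 + (2 * t - 1) * (dist a b / 2)"
      using dist_triangle[of a "bisect k ?m b (2 * t - 1)" ?m] dist_npc_mid(1)[of a b] by linarith
    also have "\<dots> = t * dist a b" by (simp add: field_simps)
    finally show ?thesis using False by simp
  qed
qed simp

text \<open>Rounding is away from \<open>b\<close>, by at most one piece; this is the term
  \<open>1 / 2 ^ k\<close>.\<close>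

lemma dist_bisect_right:
  "t \<in> {0..1} \<Longrightarrow> dist (bisect k a b t) b \<le> (1 - t + 1 / 2 ^ k) * dist a b"
proof (induction k arbitrary: a b t)
  case 0
  then have "1 * dist a b \<le> (1 - t + 1 / 2 ^ 0) * dist a b" by (intro mult_right_mono) auto
  then show ?case by simp
next
  case (Suc k)
  let ?m = "npc_mid a b"
  show ?case
  proof (cases "t \<le> 1/2")
    case True
    then have "dist (bisect k a ?m (2 * t)) ?m \<le> (1 - 2 * t + 1 / 2 ^ k) * (dist a b / 2)"
      using Suc.IH[of "2 * t" a ?m] Suc.prems by (simp add: dist_npc_mid)
    then have "dist (bisect k a ?m (2 * t)) b
        \<le> (1 - 2 * t + 1 / 2 ^ k) * (dist a b / 2) + dist a b / 2"
      using dist_triangle[of "bisect k a ?m (2 * t)" b ?m] dist_npc_mid(2)[of a b] by linarith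
    also have "\<dots> = (1 - t + 1 / 2 ^ Suc k) * dist a b" by (simp add: field_simps)
    finally show ?thesis using True by simp
  next
    case False
    then have "dist (bisect k ?m b (2 * t - 1)) b \<le> (1 - (2 * t - 1) + 1 / 2 ^ k) * (dist a b / 2)"
      using Suc.IH[of "2 * t - 1" ?m b] Suc.prems by (simp add: dist_npc_mid)
    also have "\<dots> = (1 - t + 1 / 2 ^ Suc k) * dist a b" by (simp add: field_simps)
    finally show ?thesis using False by simp
  qed
qed

lemma dist_bisect_le:
  "0 \<le> s \<Longrightarrow> s \<le> t \<Longrightarrow> t \<le> 1 \<Longrightarrow>
    dist (bisect k a b s) (bisect k a b t) \<le> (t - s + 1 / 2 ^ k) * dist a b"
proof (induction k arbitrary: a b s t)
  case (Suc k)
  let ?m = "npc_mid a b"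
  consider "t \<le> 1/2" | "1/2 < s" | "s \<le> 1/2" "1/2 < t" by linarith
  then show ?case
  proof cases
    case 1
    then have "dist (bisect k a ?m (2 * s)) (bisect k a ?m (2 * t))
        \<le> (2 * t - 2 * s + 1 / 2 ^ k) * (dist a b / 2)"
      using Suc.IH[of "2 * s" "2 * t" a ?m] Suc.prems by (simp add: dist_npc_mid)
    also have "\<dots> = (t - s + 1 / 2 ^ Suc k) * dist a b" by (simp add: field_simps)
    finally show ?thesis using 1 Suc.prems by simp
  next
    case 2
    then have "dist (bisect k ?m b (2 * s - 1)) (bisect k ?m b (2 * t - 1))
        \<le> ((2 * t - 1) - (2 * s - 1) + 1 / 2 ^ k) * (dist a b / 2)"
      using Suc.IH[of "2 * s - 1" "2 * t - 1" ?m b] Suc.prems by (simp add: dist_npc_mid)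
    also have "\<dots> = (t - s + 1 / 2 ^ Suc k) * dist a b" by (simp add: field_simps)
    finally show ?thesis using 2 Suc.prems by simp
  next
    \<comment> \<open>Here \<open>s\<close> and \<open>t\<close> lie in different halves: pass
      through the midpoint and combine the two endpoint estimates.\<close>
    case 3
    have "dist (bisect k a ?m (2 * s)) ?m \<le> (1 - 2 * s + 1 / 2 ^ k) * (dist a b / 2)"
      using dist_bisect_right[of "2 * s" k a ?m] 3 Suc.prems by (simp add: dist_npc_mid)
    moreover have "dist ?m (bisect k ?m b (2 * t - 1)) \<le> (2 * t - 1) * (dist a b / 2)"
      using dist_bisect_left[of "2 * t - 1" ?m k b] 3 Suc.prems by (simp add: dist_npc_mid)
    ultimately have "dist (bisect k a ?m (2 * s)) (bisect k ?m b (2 * t - 1))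
        \<le> (1 - 2 * s + 1 / 2 ^ k) * (dist a b / 2) + (2 * t - 1) * (dist a b / 2)"
      using dist_triangle[of "bisect k a ?m (2 * s)" "bisect k ?m b (2 * t - 1)" ?m] by linarith
    also have "\<dots> = (t - s + 1 / 2 ^ Suc k) * dist a b" by (simp add: field_simps)
    finally show ?thesis using 3 by simp
  qed
qed simp

text \<open>The first \<open>k\<close> halvings agree, so both points arise from the same piece, of
  length \<open>dist a b / 2 ^ k\<close>. This makes the approximations Cauchy.\<close>

lemma dist_bisect_add:
  "t \<in> {0..1} \<Longrightarrow> dist (bisect k a b t) (bisect (k + m) a b t) \<le> dist a b / 2 ^ k"
proof (induction k arbitrary: a b t)
  case 0
  then have "t * dist a b \<le> dist a b" by (simp add: mult_left_le_one_le)
  then show ?case using dist_bisect_left[OF 0, of a m b] by simp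
next
  case (Suc k)
  then show ?case
    using Suc.IH[of "2 * t" a "npc_mid a b"] Suc.IH[of "2 * t - 1" "npc_mid a b" b]
    by (simp add: dist_npc_mid)
qed

text \<open>By completeness the bisections converge. The limit curve inherits the upper distance
  bounds without their error terms, and the triangle inequality turns them into equalities.\<close>

lemma geodesic_exists:
  fixes a b :: "'a::global_npc_space"
  obtains \<gamma> where "geodesic \<gamma>" "\<gamma> 0 = a" "\<gamma> 1 = b"
proof -
  define d where "d = dist a b"
  have half: "(\<lambda>k. c + d / 2 ^ k) \<longlonglongrightarrow> c" for c :: real
    using tendsto_add[OF tendsto_const LIMSEQ_divide_realpow_zero[of 2 d]] by simp
  have "convergent (\<lambda>k. bisect k a b t)" if t: "t \<in> {0..1}" for t
  proof (intro Cauchy_convergent metric_CauchyI)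
    fix e :: real assume "0 < e"
    then have "\<forall>\<^sub>F k in sequentially. 0 + d / 2 ^ k < e / 2"
      using \<open>0 < e\<close> by (intro order_tendstoD(2)[OF half]) simp
    then obtain K where K: "d / 2 ^ K < e / 2" by (auto simp: eventually_sequentially)
    have near: "dist (bisect K a b t) (bisect m a b t) < e / 2" if "K \<le> m" for m
    proof -
      have "dist (bisect K a b t) (bisect m a b t) \<le> d / 2 ^ K"
        using dist_bisect_add[OF t, of K a b "m - K"] that by (simp add: d_def)
      also note K
      finally show ?thesis .
    qed
    show "\<exists>M. \<forall>m\<ge>M. \<forall>n\<ge>M. dist (bisect m a b t) (bisect n a b t) < e"
      using dist_triangle_half_r[OF near near] by blast
  qed
  moreover define \<gamma> where "\<gamma> t = lim (\<lambda>k. bisect k a b t)" for t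
  ultimately have lim: "(\<lambda>k. bisect k a b t) \<longlonglongrightarrow> \<gamma> t" if "t \<in> {0..1}" for t
    using that by (simp add: convergent_LIMSEQ_iff)
  have lip: "dist (\<gamma> s) (\<gamma> t) \<le> (t - s) * d" if "0 \<le> s" "s \<le> t" "t \<le> 1" for s t
  proof (rule tendsto_le[OF _ half])
    show "(\<lambda>k. dist (bisect k a b s) (bisect k a b t)) \<longlonglongrightarrow> dist (\<gamma> s) (\<gamma> t)"
      using that by (intro tendsto_dist lim) auto
    show "\<forall>\<^sub>F k in sequentially. dist (bisect k a b s) (bisect k a b t) \<le> (t - s) * d + d / 2 ^ k"
      using dist_bisect_le[OF that, of _ a b]
      by (intro always_eventually) (simp add: d_def distrib_right)
  qed simp
  have 0: "\<gamma> 0 = a"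
  proof -
    have "bisect k a b 0 = a" for k
      using dist_bisect_left[of 0 a k b] by simp
    then show ?thesis using lim[of 0] by (simp add: LIMSEQ_const_iff)
  qed
  have 1: "\<gamma> 1 = b"
  proof -
    have "dist (\<gamma> 1) b \<le> 0"
    proof (rule tendsto_le[OF _ half])
      show "(\<lambda>k. dist (bisect k a b 1) b) \<longlonglongrightarrow> dist (\<gamma> 1) b"
        by (intro tendsto_dist lim tendsto_const) auto
      show "\<forall>\<^sub>F k in sequentially. dist (bisect k a b 1) b \<le> 0 + d / 2 ^ k"
        using dist_bisect_right[of 1 _ a b] by (intro always_eventually) (simp add: d_def)
    qed simp
    then show ?thesis by simp
  qed
  \<comment> \<open>The three pieces cut off by \<open>s\<close> and \<open>t\<close> have upper
    bounds summing to \<open>d\<close>, so none can be strict.\<close>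
  have eq: "dist (\<gamma> s) (\<gamma> t) = (t - s) * d" if "0 \<le> s" "s \<le> t" "t \<le> 1" for s t
  proof (rule antisym[OF lip[OF that]])
    have "d \<le> dist (\<gamma> 0) (\<gamma> s) + dist (\<gamma> s) (\<gamma> t) + dist (\<gamma> t) (\<gamma> 1)"
      using dist_triangle[of a b "\<gamma> s"] dist_triangle[of "\<gamma> s" b "\<gamma> t"]
      unfolding 0 1 d_def by linarith
    then show "(t - s) * d \<le> dist (\<gamma> s) (\<gamma> t)"
      using lip[of 0 s] lip[of t 1] that by (simp add: algebra_simps)
  qed
  have "geodesic \<gamma>"
    unfolding geodesic_def
  proof (intro ballI)
    fix s t :: real assume "s \<in> {0..1}" "t \<in> {0..1}"
    then show "dist (\<gamma> s) (\<gamma> t) = \<bar>s - t\<bar> * dist (\<gamma> 0) (\<gamma> 1)"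
      using eq[of s t] eq[of t s] dist_commute[of "\<gamma> s" "\<gamma> t"]
      by (cases "s \<le> t") (simp_all add: 0 1 d_def)
  qed
  then show ?thesis using that 0 1 by blast
qed

lemma geodesicD:
  "geodesic \<gamma> \<Longrightarrow> s \<in> {0..1} \<Longrightarrow> t \<in> {0..1} \<Longrightarrow>
    dist (\<gamma> s) (\<gamma> t) = \<bar>s - t\<bar> * dist (\<gamma> 0) (\<gamma> 1)"
  unfolding geodesic_def by blast

text \<open>Parameters \<open>1 / 2 ^ k\<close> suffice for the projection argument, which lets the
  parameter tend to 0. Each one is half the previous, so the midpoint inequality can be
  iterated.\<close>

lemma geodesic_dyadic_npc:
  fixes \<gamma> :: "real \<Rightarrow> 'a::global_npc_space"
  assumes "geodesic \<gamma>"
  defines "t \<equiv> \<lambda>k::nat. 1 / 2 ^ k"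
  shows "(dist z (\<gamma> (t k)))\<^sup>2 \<le> (1 - t k) * (dist z (\<gamma> 0))\<^sup>2 + t k * (dist z (\<gamma> 1))\<^sup>2
           - t k * (1 - t k) * (dist (\<gamma> 0) (\<gamma> 1))\<^sup>2"
proof (induction k)
  case 0
  then show ?case by (simp add: t_def)
next
  case (Suc k)
  define s where "s = t (Suc k)"
  have tk: "t k = 2 * s" by (simp add: s_def t_def)
  have s: "0 \<le> s" "2 * s \<le> 1" by (simp_all add: s_def t_def)
  let ?D = "dist (\<gamma> 0) (\<gamma> 1)"
  have d: "dist (\<gamma> u) (\<gamma> v) = (v - u) * ?D" if "0 \<le> u" "u \<le> v" "v \<le> 1" for u v
    using geodesicD[OF assms(1), of u v] that by simp
  have d1: "dist (\<gamma> 0) (\<gamma> (2 * s)) = 2 * s * ?D" "dist (\<gamma> 0) (\<gamma> s) = s * ?D"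
    "dist (\<gamma> s) (\<gamma> (2 * s)) = s * ?D"
    using d[of 0 "2 * s"] d[of 0 s] d[of s "2 * s"] s by simp_all
  \<comment> \<open>Uniqueness of midpoints makes the NPC inequality available at
    \<open>\<gamma> s\<close>.\<close>
  have "npc_mid (\<gamma> 0) (\<gamma> (2 * s)) = \<gamma> s"
    by (intro npc_mid_unique) (simp_all add: d1 dist_commute[of "\<gamma> s" "\<gamma> 0"])
  then have "(dist z (\<gamma> s))\<^sup>2 \<le> 1/2 * (dist z (\<gamma> 0))\<^sup>2 + 1/2 * (dist z (\<gamma> (2 * s)))\<^sup>2 - 1/4 * (2 * s * ?D)\<^sup>2"
    using npc_mid[of z "\<gamma> 0" "\<gamma> (2 * s)"] by (simp only: d1)
  also have "\<dots> \<le> 1/2 * (dist z (\<gamma> 0))\<^sup>2 + 1/2 * ((1 - 2 * s) * (dist z (\<gamma> 0))\<^sup>2 + 2 * s * (dist z (\<gamma> 1))\<^sup>2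
           - 2 * s * (1 - 2 * s) * ?D\<^sup>2) - 1/4 * (2 * s * ?D)\<^sup>2"
    using Suc.IH unfolding tk by simp
  \<comment> \<open>The coefficients of \<open>?D\<^sup>2\<close> combine as
    \<open>s * (1 - 2 * s) + s\<^sup>2 = s * (1 - s)\<close>.\<close>
  also have "\<dots> = (1 - s) * (dist z (\<gamma> 0))\<^sup>2 + s * (dist z (\<gamma> 1))\<^sup>2 - s * (1 - s) * ?D\<^sup>2"
    by (simp add: power2_eq_square field_simps)
  finally show ?case unfolding s_def .
qed

section \<open>Projection onto closed convex sets\<close>

text \<open>A minimizing sequence is Cauchy: midpoints of its terms stay in \<open>C\<close>, hence
  are no closer to \<open>x\<close> than the infimum, and the NPC inequality then bounds the
  distance of the terms.\<close>

lemma npc_nearest_point: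
  fixes x :: "'a::global_npc_space"
  assumes "closed C" "C \<noteq> {}"
    and mid: "\<And>u v. u \<in> C \<Longrightarrow> v \<in> C \<Longrightarrow> npc_mid u v \<in> C"
  obtains p where "p \<in> C" "\<And>q. q \<in> C \<Longrightarrow> dist x p \<le> dist x q"
proof -
  define D where "D = (INF u\<in>C. (dist x u)\<^sup>2)"
  have bdd: "bdd_below ((\<lambda>u. (dist x u)\<^sup>2) ` C)" by (intro bdd_belowI2[of _ 0]) simp
  have D: "D \<le> (dist x u)\<^sup>2" if "u \<in> C" for u
    unfolding D_def using bdd that by (rule cINF_lower)
  have "\<exists>u\<in>C. (dist x u)\<^sup>2 < D + 1 / Suc k" for k
    using cINF_less_iff[OF \<open>C \<noteq> {}\<close> bdd, of "D + 1 / Suc k"] by (simp add: D_def)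
  then obtain u where u: "\<And>k. u k \<in> C" "\<And>k. (dist x (u k))\<^sup>2 < D + 1 / Suc k" by metis
  have close: "(dist (u j) (u k))\<^sup>2 \<le> 2 / Suc j + 2 / Suc k" for j k
    using D[OF mid[OF u(1)[of j] u(1)[of k]]] npc_mid[of x "u j" "u k"] u(2)[of j] u(2)[of k]
    by simp
  have "Cauchy u"
  proof (rule metric_CauchyI)
    fix e :: real assume "0 < e"
    then obtain K where "inverse (real (Suc K)) < e\<^sup>2 / 4"
      using reals_Archimedean[of "e\<^sup>2 / 4"] by auto
    then have K: "4 / real (Suc K) < e\<^sup>2" by (simp add: field_simps)
    have "dist (u j) (u k) < e" if "K \<le> j" "K \<le> k" for j k
    proof -
      have "2 / real (Suc j) \<le> 2 / Suc K" "2 / real (Suc k) \<le> 2 / Suc K"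
        using that by (auto intro!: divide_left_mono)
      then have "(dist (u j) (u k))\<^sup>2 < e\<^sup>2" using close[of j k] K by simp
      then show ?thesis using \<open>0 < e\<close> by (simp add: power_less_imp_less_base)
    qed
    then show "\<exists>M. \<forall>m\<ge>M. \<forall>n\<ge>M. dist (u m) (u n) < e" by blast
  qed
  then obtain p where p: "u \<longlonglongrightarrow> p" using Cauchy_convergent convergentD by blast
  have "p \<in> C" using \<open>closed C\<close> u(1) p by (metis closed_sequentially)
  moreover have "(dist x p)\<^sup>2 \<le> D"
  proof (rule tendsto_le)
    show "(\<lambda>k. (dist x (u k))\<^sup>2) \<longlonglongrightarrow> (dist x p)\<^sup>2" by (intro tendsto_intros p)
    show "(\<lambda>k. D + 1 / real (Suc k)) \<longlonglongrightarrow> D"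
      using LIMSEQ_inverse_real_of_nat_add[of D] by (simp only: inverse_eq_divide)
    show "\<forall>\<^sub>F k in sequentially. (dist x (u k))\<^sup>2 \<le> D + 1 / real (Suc k)"
      using u(2) by (intro always_eventually allI less_imp_le)
  qed simp
  ultimately show ?thesis
    using that[of p] D by (meson order_trans power2_le_imp_le zero_le_dist)
qed

text \<open>Compare the nearest point \<open>p\<close> with points on the geodesic from
  \<open>p\<close> to \<open>q\<close>. Minimality, divided by the parameter \<open>t\<close>, gives
  the claim with factor \<open>1 - t\<close>; then \<open>t\<close> tends to 0.\<close>

lemma npc_projection:
  fixes x :: "'a::global_npc_space"
  assumes "closed C" "C \<noteq> {}"
    and conv: "\<And>\<gamma>. geodesic \<gamma> \<Longrightarrow> \<gamma> 0 \<in> C \<Longrightarrow> \<gamma> 1 \<in> C \<Longrightarrow> \<gamma> ` {0..1} \<subseteq> C"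
  obtains p where "p \<in> C" "\<And>q. q \<in> C \<Longrightarrow> (dist p q)\<^sup>2 + (dist x p)\<^sup>2 \<le> (dist x q)\<^sup>2"
proof -
  \<comment> \<open>The NPC midpoint lies halfway along a geodesic from \<open>u\<close> to
    \<open>v\<close>.\<close>
  have "npc_mid u v \<in> C" if uv: "u \<in> C" "v \<in> C" for u v
  proof -
    obtain \<gamma> where \<gamma>: "geodesic \<gamma>" "\<gamma> 0 = u" "\<gamma> 1 = v" using geodesic_exists by blast
    have "npc_mid u v = \<gamma> (1/2)"
      using geodesicD[OF \<gamma>(1), of "1/2" 0] geodesicD[OF \<gamma>(1), of "1/2" 1]
      by (intro npc_mid_unique) (simp_all add: \<gamma>)
    then show ?thesis using conv[of \<gamma>] \<gamma> uv by (simp add: image_subset_iff)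
  qed
  then obtain p where p: "p \<in> C" "\<And>q. q \<in> C \<Longrightarrow> dist x p \<le> dist x q"
    using npc_nearest_point[OF assms(1,2)] by blast
  have "(dist p q)\<^sup>2 + (dist x p)\<^sup>2 \<le> (dist x q)\<^sup>2" if q: "q \<in> C" for q
  proof -
    obtain \<gamma> where \<gamma>: "geodesic \<gamma>" "\<gamma> 0 = p" "\<gamma> 1 = q" using geodesic_exists by blast
    have le: "(1 - 1 / 2 ^ k) * (dist p q)\<^sup>2 \<le> (dist x q)\<^sup>2 - (dist x p)\<^sup>2" for k :: nat
    proof -
      define t :: real where "t = 1 / 2 ^ k"
      have t: "0 < t" "t \<le> 1" by (simp_all add: t_def)
      have "\<gamma> t \<in> C" using conv[of \<gamma>] \<gamma> p q t by (simp add: image_subset_iff)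
      then have "(dist x p)\<^sup>2 \<le> (dist x (\<gamma> t))\<^sup>2" using p by (simp add: power_mono)
      also have "\<dots> \<le> (1 - t) * (dist x p)\<^sup>2 + t * (dist x q)\<^sup>2 - t * (1 - t) * (dist p q)\<^sup>2"
        using geodesic_dyadic_npc[OF \<gamma>(1), of x k] unfolding \<gamma> t_def .
      finally have "t * ((1 - t) * (dist p q)\<^sup>2) \<le> t * ((dist x q)\<^sup>2 - (dist x p)\<^sup>2)"
        by (simp add: algebra_simps)
      then show ?thesis using t unfolding t_def[symmetric] by simp
    qed
    have lim: "(\<lambda>k. (1 - 1 / 2 ^ k) * (dist p q)\<^sup>2) \<longlonglongrightarrow> (1 - 0) * (dist p q)\<^sup>2"
      by (intro tendsto_intros LIMSEQ_divide_realpow_zero) simp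
    have "(1 - 0) * (dist p q)\<^sup>2 \<le> (dist x q)\<^sup>2 - (dist x p)\<^sup>2"
      by (rule LIMSEQ_le_const2[OF lim]) (use le in blast)
    then show ?thesis by simp
  qed
  then show ?thesis using that p(1) by blast
qed

section \<open>Powers and majorization\<close>

lemma dist_vec_power2: "(dist u v)\<^sup>2 = (\<Sum>i\<in>UNIV. (dist (u $ i) (v $ i))\<^sup>2)"
  by (simp add: dist_vec_def L2_set_def sum_nonneg)

text \<open>Squared distances add over coordinates, so the coordinatewise midpoint works. Projection
  thus becomes available in the power.\<close>

instance vec :: (global_npc_space, finite) global_npc_space
proof
  fix x0 x1 :: "'a ^ 'b"
  have "(dist z (\<chi> i. npc_mid (x0 $ i) (x1 $ i)))\<^sup>2
      \<le> 1/2 * (dist z x0)\<^sup>2 + 1/2 * (dist z x1)\<^sup>2 - 1/4 * (dist x0 x1)\<^sup>2" for z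
    unfolding dist_vec_power2 sum_distrib_left sum.distrib[symmetric] sum_subtractf[symmetric]
    by (intro sum_mono) (use npc_mid in auto)
  then show "\<exists>y. \<forall>z. (dist z y)\<^sup>2 \<le> 1/2 * (dist z x0)\<^sup>2 + 1/2 * (dist z x1)\<^sup>2 - 1/4 * (dist x0 x1)\<^sup>2"
    by blast
qed

theorem theorem4:
  fixes x y :: "'a::global_npc_space ^ 'n"
    and f :: "'a ^ 'n \<Rightarrow> real"
  assumes "majorized_by x y"
    and "continuous_on UNIV f"
    and "geodesically_convex f"
    and "permutation_invariant f"
  shows "f x \<le> f y"
proof -
  let ?C = "{u. f u \<le> f y}"
  have closed: "closed ?C" using assms(2) by (intro closed_Collect_le continuous_on_const)
  have nonempty: "?C \<noteq> {}" by auto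
  have convex: "\<gamma> ` {0..1} \<subseteq> ?C"
    if "geodesic \<gamma>" "\<gamma> 0 \<in> ?C" "\<gamma> 1 \<in> ?C" for \<gamma>
  proof (rule image_subsetI)
    fix t :: real assume t: "t \<in> {0..1}"
    then have "f (\<gamma> t) \<le> (1 - t) * f (\<gamma> 0) + t * f (\<gamma> 1)"
      using assms(3) that(1) unfolding geodesically_convex_def by blast
    also have "\<dots> \<le> (1 - t) * f y + t * f y"
      using that(2,3) t by (intro add_mono mult_left_mono) auto
    finally show "\<gamma> t \<in> ?C" by (simp add: algebra_simps)
  qed
  obtain p where p: "p \<in> ?C"
    and proj: "\<And>q. q \<in> ?C \<Longrightarrow> (dist p q)\<^sup>2 + (dist x p)\<^sup>2 \<le> (dist x q)\<^sup>2"
    using npc_projection[OF closed nonempty convex, of x] by blast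
  obtain A :: "real ^ 'n ^ 'n" where A: "doubly_stochastic A"
    and min: "\<And>i. is_arg_min (\<lambda>z. 1/2 * (\<Sum>j\<in>UNIV. A $ i $ j * (dist z (y $ j))\<^sup>2)) (\<lambda>z. True) (x $ i)"
    using assms(1) unfolding majorized_by_def by blast
  \<comment> \<open>Chosen so that summing \<open>b i (\<sigma> i)\<close> over \<open>i\<close>
    gives the slack of the projection inequality at the rearrangement of \<open>y\<close> by
    \<open>\<sigma>\<close>.\<close>
  define b where "b i j = (dist (x $ i) (y $ j))\<^sup>2 - (dist (p $ i) (y $ j))\<^sup>2 - (dist (x $ i) (p $ i))\<^sup>2" for i j
  have "0 \<le> (\<Sum>i\<in>UNIV. b i (\<sigma> i))" if "bij \<sigma>" for \<sigma>
  proof -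
    have "f (\<chi> i. y $ \<sigma> i) = f y"
      using assms(4) that unfolding permutation_invariant_def by blast
    then show ?thesis
      using proj[of "\<chi> i. y $ \<sigma> i"] by (simp add: b_def dist_vec_power2 sum_subtractf)
  qed
  then have "0 \<le> (\<Sum>i\<in>UNIV. \<Sum>j\<in>UNIV. A $ i $ j * b i j)"
    using A unfolding doubly_stochastic_def by (intro birkhoff_dual[where s = 1]) auto
  \<comment> \<open>Minimality of \<open>x $ i\<close>, tested against \<open>p $ i\<close>, makes
    the first two terms of \<open>b\<close> contribute at most 0; the third is constant in
    \<open>j\<close> and row \<open>i\<close> sums to 1.\<close>
  also have "\<dots> \<le> (\<Sum>i\<in>UNIV. - (dist (x $ i) (p $ i))\<^sup>2)"
  proof (rule sum_mono)
    fix i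
    have "(\<Sum>j\<in>UNIV. A $ i $ j * (dist (x $ i) (y $ j))\<^sup>2) \<le> (\<Sum>j\<in>UNIV. A $ i $ j * (dist (p $ i) (y $ j))\<^sup>2)"
      using min[of i] unfolding is_arg_min_linorder by simp
    moreover have "(\<Sum>j\<in>UNIV. A $ i $ j * (dist (x $ i) (p $ i))\<^sup>2) = (dist (x $ i) (p $ i))\<^sup>2"
      using A unfolding doubly_stochastic_def by (simp add: sum_distrib_right[symmetric])
    ultimately show "(\<Sum>j\<in>UNIV. A $ i $ j * b i j) \<le> - (dist (x $ i) (p $ i))\<^sup>2"
      by (simp add: b_def right_diff_distrib sum_subtractf)
  qed
  also have "\<dots> = - (dist x p)\<^sup>2" by (simp add: dist_vec_power2 sum_negf)
  finally have "x = p" by simp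
  then show ?thesis using p by simp
qed

end
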